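(* Let $\mathcal A$ be a $J^*$-algebra, let $r,s\in(1,\infty)$, and let $D:\mathcal A\to\mathcal A$ be a mapping (not assumed linear) such that $D(sa)=sD(a)$ for all $a\in\mathcal A$. Suppose there exists a function $\phi:\mathcal A^3\to[0,\infty)$ such that $$\lim_{n\to\infty}s^{-n}\phi(s^na,s^nb,s^nc)=0$$ for all $a,b,c\in\mathcal A$, and $$\Bigl\|r\mu D\Bigl(\frac{a+b}{r}\Bigr)+r\mu D\Bigl(\frac{a-b}{r}\Bigr)-2D(\mu a)+D(cc^*c)-D(c)c^*c-cD(c)^*c-cc^*D(c)\Bigr\|\le\phi(a,b,c)$$ for all $\mu\in\mathbb T$ and all $a,b,c\in\mathcal A$. Then $D$ is a $J^*$-derivation.
   Context: Let $\mathcal H,\mathcal K$ be (complex) Hilbert spaces and let $\mathcal B(\mathcal H,\mathcal K)$ be the space of all bounded linear operators from $\mathcal H$ to $\mathcal K$ with the operator norm. A $J^*$-algebra is a closed (complex) linear subspace $\mathcal A$ of $\mathcal B(\mathcal H,\mathcal K)$ such that $xx^*x\in\mathcal A$ whenever $x\in\mathcal A$, where $x^*$ denotes the Hilbert space adjoint. Products such as $D(c)c^*c$ and $cD(c)^*c$ are products of operators in $\mathcal B(\mathcal H,\mathcal K)$, where $D(c)^*$ is the adjoint of the operator $D(c)$. A $J^*$-derivation on $\mathcal A$ is a (complex-)linear mapping $d:\mathcal A\to\mathcal A$ such that $d(aa^*a)=d(a)a^*a+a(d(a))^*a+aa^*d(a)$ for all $a\in\mathcal A$. $\mathbb T=\{\mu\in\mathbb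 C:|\mu|=1\}$ is the unit circle. *)

theory Defs
  imports "HOL-Analysis.Analysis"
begin

class scaleC =
  fixes scaleC :: "complex \<Rightarrow> 'a \<Rightarrow> 'a"  (infixr "*\<^sub>C" 75)

text \<open>Complex Hilbert spaces. The norm and the real vector space structure come from
  \<^class>\<open>banach\<close> (so completeness is included); the axioms tie them to the complex structure.
  The inner product is linear in the first argument, and the last axiom makes it positive
  definite.\<close>

class chilbert_space = banach + scaleC +
  fixes cinner :: "'a \<Rightarrow> 'a \<Rightarrow> complex"
  assumes scaleC_add_right: "c *\<^sub>C (x + y) = c *\<^sub>C x + c *\<^sub>C y"
    and scaleC_add_left: "(c + d) *\<^sub>C x = c *\<^sub>C x + d *\<^sub>C x"
    and scaleC_scaleC: "c *\<^sub>C d *\<^sub>C x = (c * d) *\<^sub>C x"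
    and scaleC_of_real: "complex_of_real t *\<^sub>C x = t *\<^sub>R x"
    and cinner_add_left: "cinner (x + y) z = cinner x z + cinner y z"
    and cinner_scaleC_left: "cinner (c *\<^sub>C x) y = c * cinner x y"
    and cinner_commute: "cinner x y = cnj (cinner y x)"
    and cinner_self: "cinner x x = complex_of_real ((norm x)\<^sup>2)"

instantiation complex :: chilbert_space
begin

definition "c *\<^sub>C (x::complex) = c * x"

definition "cinner (x::complex) y = x * cnj y"

instance
  by standard
    (auto simp: scaleC_complex_def cinner_complex_def algebra_simps scaleR_conv_of_real
       complex_norm_square simp del: of_real_power)

end

lemma norm_scaleC: "norm (c *\<^sub>C x) = cmod c * norm (x::'a::chilbert_space)"
proof -
  have "complex_of_real ((norm (c *\<^sub>C x))\<^sup>2) = c * cnj c * cinner x x"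
    by (metis cinner_self cinner_scaleC_left cinner_commute complex_cnj_mult mult.assoc)
  also have "\<dots> = complex_of_real ((cmod c * norm x)\<^sup>2)"
    unfolding cinner_self complex_norm_square[symmetric] by (simp add: power_mult_distrib)
  finally have "(norm (c *\<^sub>C x))\<^sup>2 = (cmod c * norm x)\<^sup>2"
    using of_real_eq_iff by blast
  then show ?thesis
    by (simp add: power2_eq_iff_nonneg)
qed

text \<open>The type \<^typ>\<open>'h \<Rightarrow>\<^sub>L 'k\<close> consists of the bounded real-linear operators, with the operator norm.
  The space of bounded complex-linear operators is the following subset \<open>cblinfuns\<close> of it.\<close>

instantiation blinfun :: (real_normed_vector, chilbert_space) scaleC
begin

lift_definition scaleC_blinfun :: "complex \<Rightarrow> 'a \<Rightarrow>\<^sub>L 'b \<Rightarrow> 'a \<Rightarrow>\<^sub>L 'b"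
  is "\<lambda>c T x. c *\<^sub>C T x"
proof -
  fix c :: complex and T :: "'a \<Rightarrow> 'b"
  assume "bounded_linear T"
  then interpret T: bounded_linear T .
  show "bounded_linear (\<lambda>x. c *\<^sub>C T x)"
  proof (rule bounded_linear_intro)
    show "norm (c *\<^sub>C T x) \<le> norm x * (cmod c * onorm T)" for x
      using mult_left_mono[OF onorm[OF T.bounded_linear_axioms, of x], of "cmod c"]
      by (simp add: norm_scaleC mult_ac)
  qed (simp_all add: T.add T.scaleR scaleC_add_right scaleC_scaleC mult.commute
        flip: scaleC_of_real)
qed

instance ..

end

definition cblinfuns :: "('h::chilbert_space \<Rightarrow>\<^sub>L 'k::chilbert_space) set" where
  "cblinfuns = {T. \<forall>c x. blinfun_apply T (c *\<^sub>C x) = c *\<^sub>C blinfun_apply T x}"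

text \<open>The Hilbert space adjoint; it is meaningful only on \<open>cblinfuns\<close>.\<close>

definition cadjoint ::
  "('h::chilbert_space \<Rightarrow>\<^sub>L 'k::chilbert_space) \<Rightarrow> 'k \<Rightarrow>\<^sub>L 'h"  ("_\<^sup>\<dagger>" [1000] 1000) where
  "T\<^sup>\<dagger> = (THE S. \<forall>x y. cinner (blinfun_apply T x) y = cinner x (blinfun_apply S y))"

definition Jstar_algebra :: "('h::chilbert_space \<Rightarrow>\<^sub>L 'k::chilbert_space) set \<Rightarrow> bool" where
  "Jstar_algebra \<A> \<longleftrightarrow>
     \<A> \<subseteq> cblinfuns \<and>
     0 \<in> \<A> \<and> (\<forall>x\<in>\<A>. \<forall>y\<in>\<A>. x + y \<in> \<A>) \<and> (\<forall>c. \<forall>x\<in>\<A>. c *\<^sub>C x \<in> \<A>) \<and>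
     closed \<A> \<and>
     (\<forall>x\<in>\<A>. x o\<^sub>L x\<^sup>\<dagger> o\<^sub>L x \<in> \<A>)"

definition Jstar_derivation ::
  "('h::chilbert_space \<Rightarrow>\<^sub>L 'k::chilbert_space) set \<Rightarrow> (('h \<Rightarrow>\<^sub>L 'k) \<Rightarrow> ('h \<Rightarrow>\<^sub>L 'k)) \<Rightarrow> bool" where
  "Jstar_derivation \<A> d \<longleftrightarrow>
     d \<in> \<A> \<rightarrow> \<A> \<and>
     (\<forall>a\<in>\<A>. \<forall>b\<in>\<A>. d (a + b) = d a + d b) \<and>
     (\<forall>c. \<forall>a\<in>\<A>. d (c *\<^sub>C a) = c *\<^sub>C d a) \<and>
     (\<forall>a\<in>\<A>. d (a o\<^sub>L a\<^sup>\<dagger> o\<^sub>L a) =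
        (d a o\<^sub>L a\<^sup>\<dagger> o\<^sub>L a) + (a o\<^sub>L (d a)\<^sup>\<dagger> o\<^sub>L a) + (a o\<^sub>L a\<^sup>\<dagger> o\<^sub>L d a))"

end

theory Submission
  imports Defs
begin

text \<open>
  The main hypothesis bounds the norm of a sum of two expressions: a Jensen-type expression
  in \<open>a\<close>, \<open>b\<close>, which is homogeneous of degree one under scaling by powers of \<open>s\<close>, and the
  derivation defect of \<open>c\<close>, which is homogeneous of degree three. Since \<open>D 0 = 0\<close>, each can be
  isolated by setting the other variables to zero. Replacing the variables by their multiples with
  \<open>s ^ n\<close> and dividing by \<open>s ^ n\<close> then leaves a quantity that does not decrease with \<open>n\<close>, below
  a bound that tends to zero. Both expressions therefore vanish exactly, and no approximation is
  left.

  The vanishing Jensen-type expression says \<open>r \<mu> D ((a + b) / r) + r \<mu> D ((a - b) / r) = 2 D (\<mu> a)\<close>.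
  With \<open>b = 0\<close> it gives homogeneity under unit scalars and under division by \<open>r\<close>;
  what remains is Jensen's equation, which forces additivity. An additive map that respects unit
  scalars is complex-linear, because every complex number of modulus at most 2 is a sum of two unit
  scalars (\<open>complex_homogeneous_if_unit_homogeneous\<close>).

  That the derivation defect has degree three rests on \<open>(t a)\<^sup>\<dagger> = t a\<^sup>\<dagger>\<close> for real \<open>t\<close>. The adjoint is
  specified by a definite description, so this law needs existence and uniqueness of the adjoint
  on complex-linear operators. Existence is the Riesz representation theorem, proved here by
  minimising the functional \<open>x \<mapsto> \<parallel>x\<parallel>\<^sup>2 - 2 g x\<close>.
\<close>

section \<open>The real inner product of a complex Hilbert space\<close>

definition rinner :: "'a::chilbert_space \<Rightarrow> 'a \<Rightarrow> real" where
  "rinner x y = Re (cinner x y)"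

lemma rinner_commute: "rinner x y = rinner y x"
  unfolding rinner_def by (subst cinner_commute) simp

lemma rinner_add_left: "rinner (x + y) z = rinner x z + rinner y z"
  by (simp add: rinner_def cinner_add_left)

lemma rinner_scaleR_left: "rinner (t *\<^sub>R x) y = t * rinner x y"
  by (simp add: rinner_def cinner_scaleC_left flip: scaleC_of_real)

lemma rinner_add_right: "rinner z (x + y) = rinner z x + rinner z y"
  by (metis rinner_add_left rinner_commute)

lemma rinner_scaleR_right: "rinner y (t *\<^sub>R x) = t * rinner y x"
  by (metis rinner_scaleR_left rinner_commute)

lemma rinner_diff_right: "rinner z (x - y) = rinner z x - rinner z y"
  using rinner_add_right[of z "x - y" y] by simp

lemma rinner_self: "rinner x x = (norm x)\<^sup>2"
  by (simp add: rinner_def cinner_self del: of_real_power)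

lemma norm_add_scaleR_square:
  "(norm (y + t *\<^sub>R x))\<^sup>2 = (norm y)\<^sup>2 + 2 * t * rinner x y + t\<^sup>2 * (norm x)\<^sup>2"
  unfolding rinner_self[symmetric]
  by (simp add: rinner_add_left rinner_add_right rinner_scaleR_left rinner_scaleR_right
      rinner_commute[of y x] power2_eq_square algebra_simps)

lemma norm_diff_square:
  fixes x y :: "'a::chilbert_space"
  shows "(norm (x - y))\<^sup>2 = 2 * (norm x)\<^sup>2 + 2 * (norm y)\<^sup>2 - (norm (x + y))\<^sup>2"
  using norm_add_scaleR_square[of x "-1" y] norm_add_scaleR_square[of x 1 y] by simp

text \<open>The triangle inequality is an axiom of normed spaces here, so the usual argument runs
  backwards: comparing \<open>\<parallel>y + x\<parallel>\<^sup>2\<close> with \<open>(\<parallel>y\<parallel> + \<parallel>x\<parallel>)\<^sup>2\<close> yields the Cauchy-Schwarz inequality.\<close>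

lemma rinner_le_norm: "rinner x y \<le> norm x * norm y"
proof -
  have "(norm (y + x))\<^sup>2 \<le> (norm y + norm x)\<^sup>2"
    by (intro power_mono norm_triangle_ineq norm_ge_zero)
  then show ?thesis
    using norm_add_scaleR_square[of y 1 x] by (simp add: power2_sum mult.commute)
qed

lemma rinner_eqI:
  assumes "\<And>x. rinner x y = rinner x z"
  shows "y = z"
proof -
  have "(norm (y - z))\<^sup>2 = 0"
    using assms[of "y - z"] by (simp add: rinner_diff_right flip: rinner_self)
  then show ?thesis by simp
qed

text \<open>The imaginary part of the inner product is the real part after a rotation by \<open>\<i>\<close>. Hence two
  complex-linear expressions in \<open>x\<close> agree as soon as their real parts do.\<close>

lemma cinner_conv_rinner: "cinner x y = Complex (rinner x y) (- rinner (\<i> *\<^sub>C x) y)"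
  by (simp add: rinner_def cinner_scaleC_left complex_eq_iff)

section \<open>Riesz representation and the adjoint\<close>

text \<open>The representing vector minimises \<open>J x = \<parallel>x\<parallel>\<^sup>2 - 2 g x\<close>. This functional is bounded below
  because \<open>g\<close> is bounded. By the parallelogram law, \<open>\<parallel>x - y\<parallel>\<^sup>2 / 2\<close> is
  \<open>J x + J y - 2 J ((x + y) / 2)\<close>, so minimising sequences are Cauchy, and completeness supplies a
  minimiser. There the derivative of \<open>J\<close> in every direction vanishes, which is the claim.\<close>

lemma riesz_representation:
  fixes g :: "'a::chilbert_space \<Rightarrow> real"
  assumes "bounded_linear g"
  shows "\<exists>y. \<forall>x. g x = rinner x y"
proof -
  interpret g: bounded_linear g by fact
  define J where "J x = (norm x)\<^sup>2 - 2 * g x" for x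
  define K where "K = onorm g"
  have g_le: "g x \<le> K * norm x" for x
    using onorm[OF assms, of x] by (simp add: K_def)
  have J_ge: "J x \<ge> - K\<^sup>2" for x
  proof -
    have "0 \<le> (norm x - K)\<^sup>2" by simp
    then show ?thesis
      using g_le[of x] by (simp add: J_def power2_diff algebra_simps)
  qed
  have bdd: "bdd_below (range J)"
    using J_ge by (intro bdd_belowI[of _ "- K\<^sup>2"]) auto
  define m where "m = Inf (range J)"
  have m_le: "m \<le> J x" for x
    unfolding m_def by (intro cInf_lower bdd) auto
  have "\<exists>x. J x < m + 1 / real (Suc n)" for n
    using cInf_lessD[of "range J" "m + 1 / real (Suc n)"] unfolding m_def by auto
  then obtain X where X: "\<And>n. J (X n) < m + 1 / real (Suc n)"
    by metis
  have J_mid: "(norm (x - y))\<^sup>2 = 2 * J x + 2 * J y - 4 * J ((1/2) *\<^sub>R (x + y))" for x y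
    by (simp add: J_def norm_diff_square g.add g.scaleR power_divide add_divide_distrib)
  have "Cauchy X"
  proof (rule metric_CauchyI)
    fix e :: real assume e: "e > 0"
    obtain N where N: "1 / real (Suc N) < e\<^sup>2 / 4"
      using nat_approx_posE[of "e\<^sup>2 / 4"] e by auto
    have "dist (X i) (X j) < e" if "i \<ge> N" "j \<ge> N" for i j
    proof -
      have small: "J (X k) < m + e\<^sup>2 / 4" if "k \<ge> N" for k
      proof -
        have "1 / real (Suc k) \<le> 1 / real (Suc N)"
          using that by (intro divide_left_mono) auto
        then show ?thesis using X[of k] N by linarith
      qed
      have "(norm (X i - X j))\<^sup>2 < e\<^sup>2"
        using J_mid[of "X i" "X j"] small[OF that(1)] small[OF that(2)]
          m_le[of "(1/2) *\<^sub>R (X i + X j)"] by linarith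
      then show ?thesis
        using e power_less_imp_less_base[of _ 2 e] by (simp add: dist_norm)
    qed
    then show "\<exists>M. \<forall>i\<ge>M. \<forall>j\<ge>M. dist (X i) (X j) < e" by blast
  qed
  then obtain y where y: "X \<longlonglongrightarrow> y"
    by (metis Cauchy_convergent convergent_def)
  have "(\<lambda>n. J (X n)) \<longlonglongrightarrow> J y"
    unfolding J_def by (intro tendsto_intros g.tendsto y)
  moreover have "(\<lambda>n. m + 1 / real (Suc n)) \<longlonglongrightarrow> m + 0"
    by (intro tendsto_intros LIMSEQ_Suc lim_1_over_n)
  ultimately have J_y: "J y \<le> m"
    using X by (intro LIMSEQ_le[where X = "\<lambda>n. J (X n)"]) (auto intro: less_imp_le)
  have "g x = rinner x y" for x
  proof -
    define a where "a = rinner x y - g x"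
    define q where "q = (norm x)\<^sup>2"
    have q: "q \<ge> 0" by (simp add: q_def)
    have *: "0 \<le> 2 * t * a + t\<^sup>2 * q" for t
    proof -
      have "J y \<le> J (y + t *\<^sub>R x)"
        using m_le J_y by (meson order_trans)
      then show ?thesis
        by (simp add: J_def norm_add_scaleR_square g.add g.scaleR a_def q_def algebra_simps)
    qed
    \<comment> \<open>The step \<open>- a / (q + 1)\<close> makes the first-order decrease outweigh the quadratic term also
      when \<open>q = 0\<close>.\<close>
    define u where "u = 1 / (q + 1)"
    have u: "u > 0" "u * q \<le> 1"
      using q by (auto simp: u_def field_simps)
    have "a\<^sup>2 * (u * (2 - u * q)) \<le> 0"
      using *[of "- (a * u)"] by (simp add: power2_eq_square algebra_simps)
    moreover have "u * (2 - u * q) > 0"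
      using u by (intro mult_pos_pos) auto
    ultimately have "a\<^sup>2 \<le> 0"
      by (metis mult_le_0_iff not_less)
    then show ?thesis by (simp add: a_def)
  qed
  then show ?thesis by blast
qed

text \<open>Representing the real functionals \<open>x \<mapsto> rinner (T x) y\<close> produces the adjoint with respect to
  the real inner product. Complex linearity of \<open>T\<close> enters only at the end: it makes the imaginary
  parts agree as well.\<close>

lemma adjoint_exists:
  fixes T :: "'h::chilbert_space \<Rightarrow>\<^sub>L 'k::chilbert_space"
  assumes "T \<in> cblinfuns"
  shows "\<exists>S. \<forall>x y. cinner (blinfun_apply T x) y = cinner x (blinfun_apply S y)"
proof -
  have "\<exists>z. \<forall>x. rinner (blinfun_apply T x) y = rinner x z" for y
  proof (rule riesz_representation, rule bounded_linear_intro)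
    fix x
    have "rinner (T x) y \<le> norm x * (norm T * norm y)" for x
      using rinner_le_norm[of "T x" y] mult_right_mono[OF norm_blinfun[of T x], of "norm y"]
      by (simp add: mult_ac)
    from this[of x] this[of "- x"]
    show "norm (rinner (T x) y) \<le> norm x * (norm T * norm y)"
      using rinner_scaleR_left[of "-1" "T x" y] by (simp add: blinfun.minus_right abs_le_iff)
  qed (simp_all add: blinfun.add_right blinfun.scaleR_right rinner_add_left rinner_scaleR_left)
  then obtain S where S: "\<And>x y. rinner (T x) y = rinner x (S y)"
    by metis
  have "bounded_linear S"
  proof (rule bounded_linear_intro)
    show "S (y + z) = S y + S z" for y z
      by (rule rinner_eqI) (simp add: rinner_add_right flip: S)
    show "S (t *\<^sub>R y) = t *\<^sub>R S y" for t y
      by (rule rinner_eqI) (simp add: rinner_scaleR_right flip: S)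
    show "norm (S y) \<le> norm y * norm T" for y
    proof (cases "norm (S y) = 0")
      case False
      have "norm (S y) * norm (S y) = rinner (T (S y)) y"
        by (simp add: S rinner_self power2_eq_square)
      also have "\<dots> \<le> norm (T (S y)) * norm y" by (rule rinner_le_norm)
      also have "\<dots> \<le> norm T * norm (S y) * norm y"
        by (intro mult_right_mono norm_blinfun) simp
      finally have "norm (S y) * norm (S y) \<le> norm (S y) * (norm y * norm T)"
        by (simp add: mult_ac)
      then show ?thesis using False by (simp add: mult_le_cancel_left)
    qed simp
  qed
  then have "blinfun_apply (Blinfun S) = S"
    by (rule bounded_linear_Blinfun_apply)
  moreover have "T (\<i> *\<^sub>C x) = \<i> *\<^sub>C T x" for x
    using assms by (simp add: cblinfuns_def)
  then have "cinner (T x) y = cinner x (S y)" for x y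
    unfolding cinner_conv_rinner by (metis S)
  ultimately show ?thesis
    by (intro exI[of _ "Blinfun S"]) simp
qed

lemma cadjoint_eqI:
  fixes T :: "'h::chilbert_space \<Rightarrow>\<^sub>L 'k::chilbert_space"
  assumes "\<And>x y. cinner (blinfun_apply T x) y = cinner x (blinfun_apply S y)"
  shows "T\<^sup>\<dagger> = S"
  unfolding cadjoint_def
proof (rule the_equality)
  fix S' :: "'k \<Rightarrow>\<^sub>L 'h"
  assume S': "\<forall>x y. cinner (T x) y = cinner x (S' y)"
  show "S' = S"
  proof (rule blinfun_eqI, rule rinner_eqI)
    show "rinner x (S' y) = rinner x (S y)" for x y
      using S' assms by (metis rinner_def)
  qed
qed (use assms in blast)

lemma cinner_cadjoint:
  assumes "T \<in> cblinfuns"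
  shows "cinner (blinfun_apply T x) y = cinner x (blinfun_apply T\<^sup>\<dagger> y)"
  using adjoint_exists[OF assms] cadjoint_eqI by metis

lemma cadjoint_scaleR:
  assumes "T \<in> cblinfuns"
  shows "(t *\<^sub>R T)\<^sup>\<dagger> = t *\<^sub>R T\<^sup>\<dagger>"
proof (rule cadjoint_eqI)
  have right: "cinner x (t *\<^sub>R z) = t * cinner x z" for x z :: 'a
    by (subst (1 2) cinner_commute) (simp add: cinner_scaleC_left flip: scaleC_of_real)
  have left: "cinner (t *\<^sub>R z) y = t * cinner z y" for y z :: 'b
    by (simp add: cinner_scaleC_left flip: scaleC_of_real)
  show "cinner ((t *\<^sub>R T) x) y = cinner x ((t *\<^sub>R T\<^sup>\<dagger>) y)" for x y
    by (simp add: blinfun.scaleR_left left right cinner_cadjoint[OF assms])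
qed

section \<open>From unit scalars to complex linearity\<close>

lemma scaleC_blinfun_of_real: "complex_of_real t *\<^sub>C (T :: _ \<Rightarrow>\<^sub>L _) = t *\<^sub>R T"
  by (rule blinfun_eqI) (simp add: scaleC_blinfun.rep_eq blinfun.scaleR_left scaleC_of_real)

lemma scaleC_blinfun_scaleC: "c *\<^sub>C d *\<^sub>C (T :: _ \<Rightarrow>\<^sub>L _) = (c * d) *\<^sub>C T"
  by (rule blinfun_eqI) (simp add: scaleC_blinfun.rep_eq scaleC_scaleC)

lemma scaleC_blinfun_add_left: "(c + d) *\<^sub>C (T :: _ \<Rightarrow>\<^sub>L _) = c *\<^sub>C T + d *\<^sub>C T"
  by (rule blinfun_eqI) (simp add: scaleC_blinfun.rep_eq blinfun.add_left scaleC_add_left)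

text \<open>Both summands are obtained from the direction of \<open>c\<close> by rotating it through opposite angles
  whose common cosine is \<open>cmod c / 2\<close>.\<close>

lemma complex_eq_sum_of_unit_scalars:
  assumes "cmod c \<le> 2"
  obtains u v where "cmod u = 1" "cmod v = 1" "c = u + v"
proof
  define \<omega> where "\<omega> = cis (Arg c)"
  define \<theta> where "\<theta> = arccos (cmod c / 2)"
  have "cis \<theta> + cis (- \<theta>) = complex_of_real (cmod c)"
    using assms norm_ge_zero[of c] by (simp add: \<theta>_def complex_eq_iff cos_arccos del: norm_ge_zero)
  then have "\<omega> * (cis \<theta> + cis (- \<theta>)) = c"
    using rcis_cmod_Arg[of c] by (simp add: \<omega>_def rcis_def mult.commute)
  then show "c = \<omega> * cis \<theta> + \<omega> * cis (- \<theta>)" by (simp add: distrib_left)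
  show "cmod (\<omega> * cis \<theta>) = 1" "cmod (\<omega> * cis (- \<theta>)) = 1"
    by (simp_all add: \<omega>_def norm_mult)
qed

text \<open>Scalars of modulus at most 2 are sums of two unit scalars, so additivity covers them.
  Doubling, another instance of additivity, then removes the bound on the modulus.\<close>

lemma complex_homogeneous_if_unit_homogeneous:
  fixes D :: "('h::chilbert_space \<Rightarrow>\<^sub>L 'k::chilbert_space) \<Rightarrow> ('h \<Rightarrow>\<^sub>L 'k)"
  assumes scale: "\<And>c a. a \<in> \<A> \<Longrightarrow> c *\<^sub>C a \<in> \<A>"
    and add: "\<And>a b. a \<in> \<A> \<Longrightarrow> b \<in> \<A> \<Longrightarrow> D (a + b) = D a + D b"
    and unit: "\<And>\<mu> a. cmod \<mu> = 1 \<Longrightarrow> a \<in> \<A> \<Longrightarrow> D (\<mu> *\<^sub>C a) = \<mu> *\<^sub>C D a"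
    and "a \<in> \<A>"
  shows "D (c *\<^sub>C a) = c *\<^sub>C D a"
proof -
  have small: "D (c *\<^sub>C a) = c *\<^sub>C D a" if c: "cmod c \<le> 2" and a: "a \<in> \<A>" for c a
  proof -
    obtain u v where uv: "cmod u = 1" "cmod v = 1" "c = u + v"
      using complex_eq_sum_of_unit_scalars[OF c] .
    then show ?thesis
      by (simp add: scaleC_blinfun_add_left add scale unit a)
  qed
  have bounded: "D (c *\<^sub>C a) = c *\<^sub>C D a" if "cmod c \<le> 2 ^ n" for n c
    using that
  proof (induction n arbitrary: c)
    case 0
    then show ?case by (intro small \<open>a \<in> \<A>\<close>) simp
  next
    case (Suc n)
    have c: "c *\<^sub>C T = 2 *\<^sub>C (c / 2) *\<^sub>C T" for T :: "'h \<Rightarrow>\<^sub>L 'k"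
      by (simp add: scaleC_blinfun_scaleC)
    have "D ((c / 2) *\<^sub>C a) = (c / 2) *\<^sub>C D a"
      using Suc.prems by (intro Suc.IH) (simp add: norm_divide)
    then show ?case
      by (subst (1 2) c) (simp add: small scale \<open>a \<in> \<A>\<close>)
  qed
  obtain n where "cmod c < 2 ^ n"
    using real_arch_pow[of 2 "cmod c"] by auto
  then show ?thesis by (intro bounded[of _ n]) simp
qed

section \<open>The derivation defect and vanishing by scaling\<close>

definition derivation_defect ::
  "(('h::chilbert_space \<Rightarrow>\<^sub>L 'k::chilbert_space) \<Rightarrow> ('h \<Rightarrow>\<^sub>L 'k)) \<Rightarrow> ('h \<Rightarrow>\<^sub>L 'k) \<Rightarrow> ('h \<Rightarrow>\<^sub>L 'k)" where
  "derivation_defect D c = D (c o\<^sub>L c\<^sup>\<dagger> o\<^sub>L c)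
     - (D c o\<^sub>L c\<^sup>\<dagger> o\<^sub>L c) - (c o\<^sub>L (D c)\<^sup>\<dagger> o\<^sub>L c) - (c o\<^sub>L c\<^sup>\<dagger> o\<^sub>L D c)"

lemma blinfun_compose_scaleR_left: "(t *\<^sub>R S) o\<^sub>L T = t *\<^sub>R (S o\<^sub>L T)"
  by (rule blinfun_eqI) (simp add: blinfun.scaleR_left)

lemma blinfun_compose_scaleR_right: "S o\<^sub>L (t *\<^sub>R T) = t *\<^sub>R (S o\<^sub>L T)"
  by (rule blinfun_eqI) (simp add: blinfun.scaleR_left blinfun.scaleR_right)

lemma derivation_defect_scaleR:
  assumes "c \<in> cblinfuns" "D c \<in> cblinfuns"
    and "D (t *\<^sub>R c) = t *\<^sub>R D c"
    and "D (t ^ 3 *\<^sub>R (c o\<^sub>L c\<^sup>\<dagger> o\<^sub>L c)) = t ^ 3 *\<^sub>R D (c o\<^sub>L c\<^sup>\<dagger> o\<^sub>L c)"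
  shows "derivation_defect D (t *\<^sub>R c) = t ^ 3 *\<^sub>R derivation_defect D c"
  using assms
  by (simp add: derivation_defect_def cadjoint_scaleR blinfun_compose_scaleR_left
      blinfun_compose_scaleR_right scaleR_diff_right power3_eq_cube mult.assoc)

text \<open>The bounded norm grows at least like \<open>s ^ n\<close> unless \<open>x = 0\<close>, while the bound \<open>f n\<close> is of
  smaller order than \<open>s ^ n\<close>. In the application \<open>k\<close> is 1 for the Jensen-type expression and 3 for
  the derivation defect.\<close>

lemma eq_0_if_scaled_bound_tendsto_0:
  fixes x :: "'a::real_normed_vector" and s :: real
  assumes "s > 1" and k: "k \<ge> 1"
    and bound: "\<And>n. norm ((s ^ n) ^ k *\<^sub>R x) \<le> f n"
    and lim: "(\<lambda>n. inverse (s ^ n) * f n) \<longlonglongrightarrow> 0"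
  shows "x = 0"
proof -
  have "norm x \<le> inverse (s ^ n) * f n" for n
  proof -
    have p: "s ^ n \<ge> 1" using \<open>s > 1\<close> by simp
    then have "s ^ n \<le> (s ^ n) ^ k"
      using k power_increasing[of 1 k "s ^ n"] by simp
    then have "s ^ n * norm x \<le> (s ^ n) ^ k * norm x"
      by (rule mult_right_mono) simp
    also have "\<dots> \<le> f n"
      using bound[of n] \<open>s > 1\<close> by simp
    finally show ?thesis
      using \<open>s > 1\<close> by (simp add: field_simps)
  qed
  then have "norm x \<le> 0"
    by (intro LIMSEQ_le_const[OF lim]) auto
  then show ?thesis by simp
qed

theorem theorem2p1:
  fixes \<A> :: "('h::chilbert_space \<Rightarrow>\<^sub>L 'k::chilbert_space) set"
    and r s :: real
    and D :: "('h \<Rightarrow>\<^sub>L 'k) \<Rightarrow> ('h \<Rightarrow>\<^sub>L 'k)"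
    and \<phi> :: "('h \<Rightarrow>\<^sub>L 'k) \<Rightarrow> ('h \<Rightarrow>\<^sub>L 'k) \<Rightarrow> ('h \<Rightarrow>\<^sub>L 'k) \<Rightarrow> real"
  assumes "Jstar_algebra \<A>"
    and "r > 1" and "s > 1"
    and "D \<in> \<A> \<rightarrow> \<A>"
    and "\<And>a. a \<in> \<A> \<Longrightarrow> D (s *\<^sub>R a) = s *\<^sub>R D a"
    and "\<And>a b c. a \<in> \<A> \<Longrightarrow> b \<in> \<A> \<Longrightarrow> c \<in> \<A> \<Longrightarrow> \<phi> a b c \<ge> 0"
    and "\<And>a b c. a \<in> \<A> \<Longrightarrow> b \<in> \<A> \<Longrightarrow> c \<in> \<A> \<Longrightarrow>
           (\<lambda>n. inverse (s ^ n) * \<phi> (s ^ n *\<^sub>R a) (s ^ n *\<^sub>R b) (s ^ n *\<^sub>R c)) \<longlonglongrightarrow> 0"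
    and "\<And>\<mu> a b c. cmod \<mu> = 1 \<Longrightarrow> a \<in> \<A> \<Longrightarrow> b \<in> \<A> \<Longrightarrow> c \<in> \<A> \<Longrightarrow>
           norm ((complex_of_real r * \<mu>) *\<^sub>C D ((a + b) /\<^sub>R r)
               + (complex_of_real r * \<mu>) *\<^sub>C D ((a - b) /\<^sub>R r)
               - 2 *\<^sub>R D (\<mu> *\<^sub>C a)
               + D (c o\<^sub>L c\<^sup>\<dagger> o\<^sub>L c)
               - (D c o\<^sub>L c\<^sup>\<dagger> o\<^sub>L c)
               - (c o\<^sub>L (D c)\<^sup>\<dagger> o\<^sub>L c)
               - (c o\<^sub>L c\<^sup>\<dagger> o\<^sub>L D c)) \<le> \<phi> a b c"
  shows "Jstar_derivation \<A> D"
proof -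
  note alg = assms(1) and r = assms(2) and s = assms(3) and D_in = assms(4)
    and D_s = assms(5) and lim = assms(7) and bound = assms(8)
  have zero_in: "0 \<in> \<A>" and add_in: "\<And>a b. a \<in> \<A> \<Longrightarrow> b \<in> \<A> \<Longrightarrow> a + b \<in> \<A>"
    and scaleC_in: "\<And>c a. a \<in> \<A> \<Longrightarrow> c *\<^sub>C a \<in> \<A>"
    and cube_in: "\<And>a. a \<in> \<A> \<Longrightarrow> a o\<^sub>L a\<^sup>\<dagger> o\<^sub>L a \<in> \<A>"
    and cbl: "\<And>a. a \<in> \<A> \<Longrightarrow> a \<in> cblinfuns"
    using alg by (auto simp: Jstar_algebra_def)
  have scaleR_in: "t *\<^sub>R a \<in> \<A>" if "a \<in> \<A>" for t a
    using scaleC_in[OF that, of "complex_of_real t"] by (simp add: scaleC_blinfun_of_real)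
  have diff_in: "a - b \<in> \<A>" if "a \<in> \<A>" "b \<in> \<A>" for a b
    using add_in[OF that(1) scaleR_in[OF that(2), of "-1"]] by simp
  have D_pow: "D (s ^ n *\<^sub>R a) = s ^ n *\<^sub>R D a" if "a \<in> \<A>" for n a
  proof (induction n)
    case (Suc n)
    then show ?case
      using D_s[OF scaleR_in[OF that, of "s ^ n"]] by simp
  qed simp
  have "(s - 1) *\<^sub>R D 0 = 0"
    using D_s[OF zero_in] by (simp add: scaleR_diff_left)
  then have D_0: "D 0 = 0"
    using s by simp

  define jensen where "jensen \<mu> a b = (complex_of_real r * \<mu>) *\<^sub>C D ((a + b) /\<^sub>R r)
    + (complex_of_real r * \<mu>) *\<^sub>C D ((a - b) /\<^sub>R r) - 2 *\<^sub>R D (\<mu> *\<^sub>C a)" for \<mu> a b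
  have scaleC_scaleR: "c *\<^sub>C (t *\<^sub>R T) = t *\<^sub>R (c *\<^sub>C T)" for c t and T :: "'h \<Rightarrow>\<^sub>L 'k"
    by (simp add: scaleC_blinfun_scaleC mult.commute flip: scaleC_blinfun_of_real)
  have defect_0: "derivation_defect D 0 = 0"
    by (simp add: derivation_defect_def D_0)
  have jensen_0: "jensen 1 0 0 = 0"
    by (simp add: jensen_def D_0 scaleC_blinfun_of_real scaleC_blinfun_of_real[of 1, simplified])
  have both: "norm (jensen \<mu> a b + derivation_defect D c) \<le> \<phi> a b c"
    if "cmod \<mu> = 1" "a \<in> \<A>" "b \<in> \<A>" "c \<in> \<A>" for \<mu> a b c
    using bound[OF that] by (simp add: jensen_def derivation_defect_def algebra_simps)

  have jensen_eq_0: "jensen \<mu> a b = 0" if "cmod \<mu> = 1" "a \<in> \<A>" "b \<in> \<A>" for \<mu> a b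
  proof (rule eq_0_if_scaled_bound_tendsto_0[OF s le_refl])
    show "(\<lambda>n. inverse (s ^ n) * \<phi> (s ^ n *\<^sub>R a) (s ^ n *\<^sub>R b) 0) \<longlonglongrightarrow> 0"
      using lim[OF that(2,3) zero_in] by simp
    fix n
    have "D ((s ^ n *\<^sub>R a + s ^ n *\<^sub>R b) /\<^sub>R r) = s ^ n *\<^sub>R D ((a + b) /\<^sub>R r)"
      using D_pow[OF scaleR_in[OF add_in[OF that(2,3)]], of n "inverse r"]
      by (simp add: mult.commute flip: scaleR_add_right)
    moreover have "D ((s ^ n *\<^sub>R a - s ^ n *\<^sub>R b) /\<^sub>R r) = s ^ n *\<^sub>R D ((a - b) /\<^sub>R r)"
      using D_pow[OF scaleR_in[OF diff_in[OF that(2,3)]], of n "inverse r"]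
      by (simp add: mult.commute flip: scaleR_diff_right)
    moreover have "D (\<mu> *\<^sub>C s ^ n *\<^sub>R a) = s ^ n *\<^sub>R D (\<mu> *\<^sub>C a)"
      by (simp add: scaleC_scaleR D_pow scaleC_in that)
    ultimately have "jensen \<mu> (s ^ n *\<^sub>R a) (s ^ n *\<^sub>R b) = s ^ n *\<^sub>R jensen \<mu> a b"
      by (simp add: jensen_def scaleC_scaleR scaleR_add_right scaleR_diff_right
          scaleR_left_commute[of 2])
    then show "norm ((s ^ n) ^ 1 *\<^sub>R jensen \<mu> a b) \<le> \<phi> (s ^ n *\<^sub>R a) (s ^ n *\<^sub>R b) 0"
      using both[OF that(1) scaleR_in[OF that(2), of "s ^ n"] scaleR_in[OF that(3), of "s ^ n"]
          zero_in] by (simp add: defect_0)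
  qed

  have defect_eq_0: "derivation_defect D c = 0" if c: "c \<in> \<A>" for c
  proof (rule eq_0_if_scaled_bound_tendsto_0[OF s])
    show "(\<lambda>n. inverse (s ^ n) * \<phi> 0 0 (s ^ n *\<^sub>R c)) \<longlonglongrightarrow> 0"
      using lim[OF zero_in zero_in c] by simp
    fix n
    have "D ((s ^ n) ^ 3 *\<^sub>R (c o\<^sub>L c\<^sup>\<dagger> o\<^sub>L c)) = (s ^ n) ^ 3 *\<^sub>R D (c o\<^sub>L c\<^sup>\<dagger> o\<^sub>L c)"
      using D_pow[OF cube_in[OF c], of "n * 3"] by (simp add: power_mult)
    then have "derivation_defect D (s ^ n *\<^sub>R c) = (s ^ n) ^ 3 *\<^sub>R derivation_defect D c"
      using c D_in by (intro derivation_defect_scaleR cbl D_pow) auto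
    then show "norm ((s ^ n) ^ 3 *\<^sub>R derivation_defect D c) \<le> \<phi> 0 0 (s ^ n *\<^sub>R c)"
      using both[of 1, OF _ zero_in zero_in scaleR_in[OF c, of "s ^ n"]]
      by (simp add: jensen_0)
  qed simp

  have unit_r: "(complex_of_real r * \<mu>) *\<^sub>C D (a /\<^sub>R r) = D (\<mu> *\<^sub>C a)"
    if "cmod \<mu> = 1" "a \<in> \<A>" for \<mu> a
    using jensen_eq_0[OF that zero_in] by (simp add: jensen_def flip: scaleR_2)
  have one: "1 *\<^sub>C T = T" for T :: "'h \<Rightarrow>\<^sub>L 'k"
    using scaleC_blinfun_of_real[of 1 T] by simp
  have D_r: "r *\<^sub>R D (a /\<^sub>R r) = D a" if "a \<in> \<A>" for a
    using unit_r[of 1, OF _ that] by (simp add: one scaleC_blinfun_of_real)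
  have unit: "D (\<mu> *\<^sub>C a) = \<mu> *\<^sub>C D a" if "cmod \<mu> = 1" "a \<in> \<A>" for \<mu> a
    using unit_r[OF that] D_r[OF that(2)]
    by (simp add: mult.commute[of _ \<mu>] scaleC_blinfun_of_real flip: scaleC_blinfun_scaleC)
  have midpoint: "D (a + b) + D (a - b) = 2 *\<^sub>R D a" if "a \<in> \<A>" "b \<in> \<A>" for a b
    using jensen_eq_0[of 1, OF _ that] D_r[OF add_in[OF that]] D_r[OF diff_in[OF that]]
    by (simp add: jensen_def one scaleC_blinfun_of_real)
  have add: "D (a + b) = D a + D b" if "a \<in> \<A>" "b \<in> \<A>" for a b
  proof -
    \<comment> \<open>Jensen's equation at the midpoint \<open>x\<close> of \<open>a\<close> and \<open>b\<close>, and at \<open>(x, x)\<close>.\<close>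
    define x y where "x = (1/2) *\<^sub>R (a + b)" and "y = (1/2) *\<^sub>R (a - b)"
    have in_A: "x \<in> \<A>" "y \<in> \<A>"
      using that by (auto simp: x_def y_def intro: scaleR_in add_in diff_in)
    have xy: "x + y = a" "x - y = b" "x + x = a + b"
      by (simp_all add: x_def y_def algebra_simps flip: scaleR_add_left)
    show ?thesis
      using midpoint[OF in_A] midpoint[OF in_A(1) in_A(1)] by (simp add: xy D_0)
  qed
  have "D (c *\<^sub>C a) = c *\<^sub>C D a" if "a \<in> \<A>" for c a
    using scaleC_in add unit that by (rule complex_homogeneous_if_unit_homogeneous)
  moreover have "D (a o\<^sub>L a\<^sup>\<dagger> o\<^sub>L a) =
      (D a o\<^sub>L a\<^sup>\<dagger> o\<^sub>L a) + (a o\<^sub>L (D a)\<^sup>\<dagger> o\<^sub>L a) + (a o\<^sub>L a\<^sup>\<dagger> o\<^sub>L D a)" if "a \<in> \<A>" for a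
    using defect_eq_0[OF that] by (simp add: derivation_defect_def algebra_simps)
  ultimately show ?thesis
    using D_in add by (simp add: Jstar_derivation_def)
qed

end
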